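(* Let $X$ be a GGC with Thorin mass $D<\infty$ and $\mathbb{E}[X]=1$. Then $U\leq_{\mathrm{cx}}X$, where $U\sim\mathrm{Gamma}(D,D)$.
   Context: $\mathrm{Gamma}(D,\theta)$ denotes the Gamma distribution with shape $D$ and rate $\theta$, with density $\theta^Dx^{D-1}e^{-\theta x}/\Gamma(D)$ on $(0,\infty)$. A GGC (generalized gamma convolution) here is a nonnegative random variable $X$ with $\mathbb{E}[e^{-sX}]=\exp\left(-\int_0^\infty\log(1+s/u)\,\mu(du)\right)$ for $s\ge0$, where $\mu$ (the Thorin measure of $X$) is a nonzero nonnegative measure on $(0,\infty)$ with $\int_{(0,1]}|\log u|\,\mu(du)+\int_{(1,\infty)}u^{-1}\,\mu(du)<\infty$. The Thorin mass of $X$ is $\int_0^\infty\mu(du)$. Convex order: $U\leq_{\mathrm{cx}}X$ means $\mathbb{E}[g(U)]\le\mathbb{E}[g(X)]$ for all convex functions $g$ for which the expectations exist. *)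

theory Defs
  imports "HOL-Probability.Probability"
begin

definition gamma_density :: "real \<Rightarrow> real \<Rightarrow> real \<Rightarrow> real" where
  "gamma_density D \<theta> x =
     (if 0 < x then \<theta> powr D * x powr (D - 1) * exp (- \<theta> * x) / Gamma D else 0)"

(* The Thorin measure lives on the Borel sets of the open half-line, so space \<mu> = {0<..}.
   The integrability clause is not an extra restriction: where the integral diverges, the
   right-hand side of the transform identity reads exp (-\<infinity>) = 0, which is impossible for a
   real-valued X. It is spelled out because the Bochner integral of a non-integrable
   function is 0. *)
definition GGC :: "'a measure \<Rightarrow> ('a \<Rightarrow> real) \<Rightarrow> real measure \<Rightarrow> bool" where
  "GGC M X \<mu> \<longleftrightarrow>
     X \<in> borel_measurable M \<and> (AE \<omega> in M. 0 \<le> X \<omega>) \<and>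
     sets \<mu> = sets (restrict_space borel {0<..}) \<and>
     emeasure \<mu> (space \<mu>) \<noteq> 0 \<and>
     (\<integral>\<^sup>+u\<in>{0<..1}. ennreal \<bar>ln u\<bar> \<partial>\<mu>) + (\<integral>\<^sup>+u\<in>{1<..}. ennreal (1 / u) \<partial>\<mu>) < \<infinity> \<and>
     (\<forall>s\<ge>0. integrable \<mu> (\<lambda>u. ln (1 + s / u)) \<and>
        (\<integral>\<omega>. exp (- s * X \<omega>) \<partial>M) = exp (- (\<integral>u. ln (1 + s / u) \<partial>\<mu>)))"

definition thorin_mass :: "real measure \<Rightarrow> ennreal" where
  "thorin_mass \<mu> = (\<integral>\<^sup>+u. 1 \<partial>\<mu>)"

(* An expectation exists when the positive or the negative part has a finite integral;
   its value may then be \<plusminus>\<infinity>. *)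
definition expectation_exists :: "'a measure \<Rightarrow> ('a \<Rightarrow> real) \<Rightarrow> bool" where
  "expectation_exists M f \<longleftrightarrow> f \<in> borel_measurable M \<and>
     ((\<integral>\<^sup>+\<omega>. ennreal (f \<omega>) \<partial>M) < \<infinity> \<or> (\<integral>\<^sup>+\<omega>. ennreal (- f \<omega>) \<partial>M) < \<infinity>)"

definition ext_expectation :: "'a measure \<Rightarrow> ('a \<Rightarrow> real) \<Rightarrow> ereal" where
  "ext_expectation M f =
     enn2ereal (\<integral>\<^sup>+\<omega>. ennreal (f \<omega>) \<partial>M) - enn2ereal (\<integral>\<^sup>+\<omega>. ennreal (- f \<omega>) \<partial>M)"

lemma integrable_imp_expectation_exists:
  assumes "integrable M f"
  shows "expectation_exists M f"
  using assms by (auto simp: expectation_exists_def real_integrable_def top.not_eq_extremum)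

lemma ext_expectation_eq_integral:
  assumes "integrable M f"
  shows "ext_expectation M f = ereal (\<integral>\<omega>. f \<omega> \<partial>M)"
proof -
  obtain r q where "0 \<le> r" "0 \<le> q"
    "(\<integral>\<^sup>+\<omega>. ennreal (f \<omega>) \<partial>M) = ennreal r"
    "(\<integral>\<^sup>+\<omega>. ennreal (- f \<omega>) \<partial>M) = ennreal q"
    "f \<in> borel_measurable M" "(\<integral>\<omega>. f \<omega> \<partial>M) = r - q"
    using assms by (rule integrableE)
  then show ?thesis
    by (simp add: ext_expectation_def enn2ereal_ennreal)
qed

definition convex_order ::
  "'b measure \<Rightarrow> ('b \<Rightarrow> real) \<Rightarrow> 'a measure \<Rightarrow> ('a \<Rightarrow> real) \<Rightarrow> bool" where
  "convex_order N U M X \<longleftrightarrow>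
     (\<forall>g :: real \<Rightarrow> real. convex_on UNIV g \<longrightarrow>
        expectation_exists N (\<lambda>\<omega>. g (U \<omega>)) \<longrightarrow> expectation_exists M (\<lambda>\<omega>. g (X \<omega>)) \<longrightarrow>
        ext_expectation N (\<lambda>\<omega>. g (U \<omega>)) \<le> ext_expectation M (\<lambda>\<omega>. g (X \<omega>)))"

end

theory Submission
  imports Defs "HOL-Real_Asymp.Real_Asymp"
begin

text \<open>
  If the Thorin measure has finitely many atoms \<open>1 / v\<^sub>i\<close> of mass \<open>a\<^sub>i\<close>, then \<open>X\<close> has the law of
  \<open>\<Sum> v\<^sub>i G\<^sub>i\<close> with independent \<open>G\<^sub>i \<sim> Gamma(a\<^sub>i, 1)\<close>. Given the sum of two independent gamma
  variables, their shares are beta distributed, so Jensen's inequality for the beta law and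
  induction give \<open>c G \<le>\<^sub>c\<^sub>x \<Sum> v\<^sub>i G\<^sub>i\<close>, where \<open>G \<sim> Gamma(D, 1)\<close>, \<open>D = \<Sum> a\<^sub>i\<close> and
  \<open>c = \<Sum> a\<^sub>i v\<^sub>i / D\<close>.
  In general, simple functions increasing to \<open>1 / u\<close> give such sums whose Laplace transforms
  converge to that of \<open>X\<close>. Since a continuous function on \<open>[0, \<infinity>)\<close> with bounded support is a
  uniform limit of polynomials in \<open>exp (-x)\<close>, the inequality passes to the limit for convex test
  functions vanishing near infinity, and then to all convex functions because the means of \<open>U\<close>
  and \<open>X\<close> agree.
\<close>

section \<open>Gamma and beta laws\<close>

lemma convex_imp_borel_measurable:
  fixes h :: "real \<Rightarrow> real"
  assumes "convex_on UNIV h"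
  shows "h \<in> borel_measurable borel"
  using convex_on_continuous[OF open_UNIV assms] by (rule borel_measurable_continuous_onI)

lemma gamma_density_measurable [measurable]: "gamma_density a \<theta> \<in> borel_measurable borel"
  unfolding gamma_density_def by measurable

lemma gamma_density_nonneg: "0 < a \<Longrightarrow> 0 \<le> gamma_density a \<theta> x"
  unfolding gamma_density_def by (auto intro!: divide_nonneg_pos Gamma_real_pos)

lemma gamma_density_scale:
  assumes "0 < a" "0 < c"
  shows "c * gamma_density a \<theta> (c * x) = gamma_density a (c * \<theta>) x"
  using assms
  by (auto simp: gamma_density_def zero_less_mult_iff powr_mult powr_diff mult_ac)

lemma nn_integral_gamma_density:
  assumes a: "0 < a" and th: "0 < \<theta>"
  shows "(\<integral>\<^sup>+x. ennreal (gamma_density a \<theta> x) \<partial>lborel) = 1"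
proof -
  have G: "Gamma a > 0" using a by (rule Gamma_real_pos)
  have std: "(\<integral>\<^sup>+x. ennreal (gamma_density a 1 x) \<partial>lborel) = 1"
  proof -
    have "(\<integral>\<^sup>+x. ennreal (gamma_density a 1 x) \<partial>lborel)
        = (\<integral>\<^sup>+x. ennreal (1 / Gamma a) * ennreal (indicator {0..} x * x powr (a - 1) / exp x) \<partial>lborel)"
    proof (rule nn_integral_cong_AE)
      have "AE x in lborel. x \<noteq> (0::real)" by (rule AE_lborel_singleton)
      then show "AE x in lborel. ennreal (gamma_density a 1 x)
        = ennreal (1 / Gamma a) * ennreal (indicator {0..} x * x powr (a - 1) / exp x)"
      proof eventually_elim
        case (elim x)
        then show ?case using G
          by (subst ennreal_mult'[symmetric])
             (auto simp: gamma_density_def indicator_def exp_minus field_simps)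
      qed
    qed
    also have "\<dots> = ennreal (1 / Gamma a) * ennreal (Gamma a)"
      using a by (subst nn_integral_cmult) (auto simp: Gamma_conv_nn_integral_real)
    also have "\<dots> = 1"
      using G by (subst ennreal_mult'[symmetric]) auto
    finally show ?thesis .
  qed
  have "(\<integral>\<^sup>+x. ennreal (gamma_density a 1 x) \<partial>lborel)
      = ennreal \<bar>\<theta>\<bar> * (\<integral>\<^sup>+x. ennreal (gamma_density a 1 (0 + \<theta> * x)) \<partial>lborel)"
    using th by (intro nn_integral_real_affine) auto
  also have "\<dots> = (\<integral>\<^sup>+x. ennreal (gamma_density a \<theta> x) \<partial>lborel)"
    using th gamma_density_scale[OF a th, of 1]
    by (subst nn_integral_cmult[symmetric]) (auto simp: ennreal_mult'[symmetric])
  finally show ?thesis using std by simp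
qed

text \<open>The rate is fixed at 1; all other scales enter as factors of the variable inside the
  test function.\<close>

definition gamma_measure :: "real \<Rightarrow> real measure" where
  "gamma_measure a = density lborel (\<lambda>x. ennreal (gamma_density a 1 x))"

lemma sets_gamma_measure [measurable_cong, simp]: "sets (gamma_measure a) = sets borel"
  and space_gamma_measure [simp]: "space (gamma_measure a) = UNIV"
  by (simp_all add: gamma_measure_def)

lemma prob_space_gamma_measure: "0 < a \<Longrightarrow> prob_space (gamma_measure a)"
  unfolding gamma_measure_def
  by (rule prob_spaceI) (simp add: emeasure_density nn_integral_gamma_density)

lemma nn_integral_gamma_measure:
  "f \<in> borel_measurable borel \<Longrightarrow>
   (\<integral>\<^sup>+x. f x \<partial>gamma_measure a) = (\<integral>\<^sup>+x. ennreal (gamma_density a 1 x) * f x \<partial>lborel)"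
  unfolding gamma_measure_def by (rule nn_integral_density) auto

lemma AE_gamma_measure_pos: "AE x in gamma_measure a. 0 < x"
  unfolding gamma_measure_def
  by (subst AE_density) (auto simp: gamma_density_def)

text \<open>Exponential tilting only changes the rate, so the Laplace transform can be read off from
  the normalization of the density with rate \<open>1 + s\<close>.\<close>

lemma gamma_density_tilt:
  assumes "0 < a" "0 \<le> s"
  shows "gamma_density a 1 x * exp (- s * x) = (1 + s) powr (- a) * gamma_density a (1 + s) x"
  using assms Gamma_real_pos[of a]
  by (auto simp: gamma_density_def powr_minus field_simps exp_add[symmetric])

lemma laplace_gamma_measure:
  assumes "0 < a" "0 \<le> s"
  shows "(\<integral>\<^sup>+x. ennreal (exp (- s * x)) \<partial>gamma_measure a) = ennreal ((1 + s) powr (- a))"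
proof -
  have "(\<integral>\<^sup>+x. ennreal (exp (- s * x)) \<partial>gamma_measure a)
      = (\<integral>\<^sup>+x. ennreal ((1 + s) powr (- a)) * ennreal (gamma_density a (1 + s) x) \<partial>lborel)"
    by (subst nn_integral_gamma_measure)
       (auto simp: ennreal_mult'[symmetric] ennreal_mult''[symmetric]
          gamma_density_tilt[OF assms, unfolded mult_minus_left] intro!: nn_integral_cong)
  also have "\<dots> = ennreal ((1 + s) powr (- a))"
    using assms by (subst nn_integral_cmult) (auto simp: nn_integral_gamma_density)
  finally show ?thesis .
qed

section \<open>Beta laws as laws of gamma shares\<close>

definition beta_measure :: "real \<Rightarrow> real \<Rightarrow> real measure" where
  "beta_measure a b = density lborel
     (\<lambda>x. ennreal (indicator {0<..<1} x * x powr (a - 1) * (1 - x) powr (b - 1) / Beta a b))"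

lemma sets_beta_measure [measurable_cong, simp]: "sets (beta_measure a b) = sets borel"
  and space_beta_measure [simp]: "space (beta_measure a b) = UNIV"
  by (simp_all add: beta_measure_def)

lemma Beta_real_pos: "0 < a \<Longrightarrow> 0 < b \<Longrightarrow> 0 < Beta a (b :: real)"
  by (simp add: Beta_def Gamma_real_pos)

lemma nn_integral_Beta:
  assumes "0 < a" "0 < b"
  shows "(\<integral>\<^sup>+x. ennreal (indicator {0<..<1} x * x powr (a - 1) * (1 - x) powr (b - 1)) \<partial>lborel)
    = ennreal (Beta a b)"
proof -
  have "(\<integral>\<^sup>+x. ennreal (indicator {0<..<1} x * x powr (a - 1) * (1 - x) powr (b - 1)) \<partial>lborel)
    = (\<integral>\<^sup>+x. ennreal (indicator {0..1} x * (x powr (a - 1) * (1 - x) powr (b - 1))) \<partial>lborel)"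
    by (intro nn_integral_cong) (auto simp: indicator_def)
  also have "\<dots> = ennreal (Beta a b)"
    using nn_integral_has_integral_lebesgue[OF _ has_integral_Beta_real[OF assms]] by simp
  finally show ?thesis .
qed

lemma prob_space_beta_measure:
  assumes "0 < a" "0 < b"
  shows "prob_space (beta_measure a b)"
proof (rule prob_spaceI)
  have "emeasure (beta_measure a b) (space (beta_measure a b))
    = (\<integral>\<^sup>+x. ennreal (1 / Beta a b) *
        ennreal (indicator {0<..<1} x * x powr (a - 1) * (1 - x) powr (b - 1)) \<partial>lborel)"
    using Beta_real_pos[OF assms] unfolding beta_measure_def
    by (subst emeasure_density) (auto simp: ennreal_mult'[symmetric] intro!: nn_integral_cong)
  also have "\<dots> = 1"
    using Beta_real_pos[OF assms]
    by (subst nn_integral_cmult) (auto simp: nn_integral_Beta[OF assms] ennreal_mult'[symmetric])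
  finally show "emeasure (beta_measure a b) (space (beta_measure a b)) = 1" .
qed

lemma AE_beta_measure: "AE x in beta_measure a b. 0 < x \<and> x < 1"
  unfolding beta_measure_def by (subst AE_density) (auto simp: indicator_def)

text \<open>A factor \<open>x\<close> raises the first parameter by one, so the mean is the quotient
  \<open>Beta (a + 1) b / Beta a b\<close>.\<close>

lemma beta_measure_mean:
  assumes ab: "0 < a" "0 < b"
  shows "has_bochner_integral (beta_measure a b) (\<lambda>x. x) (a / (a + b))"
proof (rule has_bochner_integral_nn_integral)
  have B: "0 < Beta a b" by (rule Beta_real_pos[OF ab])
  have "(\<integral>\<^sup>+x. ennreal x \<partial>beta_measure a b)
    = (\<integral>\<^sup>+x. ennreal (1 / Beta a b) *
        ennreal (indicator {0<..<1} x * x powr ((a + 1) - 1) * (1 - x) powr (b - 1)) \<partial>lborel)"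
    using B unfolding beta_measure_def
    by (subst nn_integral_density)
       (auto simp: ennreal_mult'[symmetric] ennreal_mult''[symmetric] indicator_def powr_diff
          field_simps intro!: nn_integral_cong)
  also have "\<dots> = ennreal (1 / Beta a b) * ennreal (Beta (a + 1) b)"
    using ab nn_integral_Beta[of "a + 1" b] by (subst nn_integral_cmult) auto
  also have "\<dots> = ennreal (Beta (a + 1) b / Beta a b)"
    using B by (subst ennreal_mult'[symmetric]) auto
  also have "Beta (a + 1) b / Beta a b = a / (a + b)"
    using Beta_plus1_left[of a b] ab B by (simp add: field_simps nonpos_Ints_def)
  finally show "(\<integral>\<^sup>+x. ennreal x \<partial>beta_measure a b) = ennreal (a / (a + b))" .
qed (use ab AE_beta_measure[of a b] in auto)

text \<open>In the coordinates sum \<open>t\<close> and share \<open>x\<close>, with Jacobian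
  \<open>t\<close>, the exponentials merge to \<open>exp (- t)\<close> and the powers of
  \<open>t\<close> to \<open>t powr (a + b - 1)\<close>. The factorization expresses that the sum
  and the share of two independent gamma variables are independent, the share being beta
  distributed.\<close>

lemma gamma_density_beta:
  assumes ab: "0 < a" "0 < b" and t: "0 < t"
  shows "t * gamma_density a 1 (t * x) * gamma_density b 1 (t - t * x)
    = gamma_density (a + b) 1 t *
      (indicator {0<..<1} x * x powr (a - 1) * (1 - x) powr (b - 1) / Beta a b)"
proof (cases "0 < x \<and> x < 1")
  case True
  have G: "Gamma a > 0" "Gamma b > 0" "Gamma (a + b) > 0" using ab by (auto intro: Gamma_real_pos)
  have eq: "t - t * x = t * (1 - x)" by (simp add: algebra_simps)
  have "t * t powr (a - 1) * t powr (b - 1) = t powr (a + b - 1)"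
    using t by (simp add: powr_diff powr_add)
  moreover have "exp (- (t * x)) * exp (- (t * (1 - x))) = exp (- t)"
    by (simp add: exp_add[symmetric] algebra_simps)
  moreover have "t * ((t * x) powr (a - 1) * exp (- (t * x))) * ((t * (1 - x)) powr (b - 1) * exp (- (t * (1 - x))))
    = (t * t powr (a - 1) * t powr (b - 1)) * (exp (- (t * x)) * exp (- (t * (1 - x))))
      * (x powr (a - 1) * (1 - x) powr (b - 1))"
    using True t by (simp add: powr_mult mult_ac)
  ultimately have "t * ((t * x) powr (a - 1) * exp (- (t * x))) * ((t * (1 - x)) powr (b - 1) * exp (- (t * (1 - x))))
    = t powr (a + b - 1) * exp (- t) * (x powr (a - 1) * (1 - x) powr (b - 1))"
    by simp
  then show ?thesis
    using True t G unfolding eq gamma_density_def Beta_def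
    by (simp add: field_simps)
next
  case False
  then have "t - t * x \<le> 0 \<or> t * x \<le> 0"
    using t by (auto simp: mult_le_0_iff)
  then show ?thesis using False by (auto simp: gamma_density_def indicator_def)
qed

lemma beta_jensen:
  fixes h :: "real \<Rightarrow> real"
  assumes ab: "0 < a" "0 < b" and h: "convex_on UNIV h" "\<And>x. 0 \<le> h x"
  shows "ennreal (h ((a * p + b * q) / (a + b))) \<le> (\<integral>\<^sup>+x. ennreal (h (x * p + (1 - x) * q)) \<partial>beta_measure a b)"
proof -
  interpret B: prob_space "beta_measure a b" using ab by (rule prob_space_beta_measure)
  have [measurable]: "h \<in> borel_measurable borel" by (rule convex_imp_borel_measurable[OF h(1)])
  note m = beta_measure_mean[OF ab]
  have int: "integrable (beta_measure a b) (\<lambda>x. x)"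
    and mean: "B.expectation (\<lambda>x. x) = a / (a + b)"
    using m by (auto simp: has_bochner_integral_iff)
  \<comment> \<open>For a weight \<open>x\<close> in (0,1) the chord bound
    \<open>x * h p + (1 - x) * h q\<close> is at most \<open>h p + h q\<close>, because
    \<open>h\<close> is nonnegative.\<close>
  have hint: "integrable (beta_measure a b) (\<lambda>x. h (x * p + (1 - x) * q))"
  proof (rule B.integrable_const_bound[where B="h p + h q"])
    show "AE x in beta_measure a b. norm (h (x * p + (1 - x) * q)) \<le> h p + h q"
      using AE_beta_measure[of a b]
    proof eventually_elim
      case (elim x)
      then have "h (x * p + (1 - x) * q) \<le> x * h p + (1 - x) * h q"
        using convex_onD[OF h(1), of "1 - x" p q] by simp
      also have "\<dots> \<le> 1 * h p + 1 * h q"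
        using elim h(2) by (intro add_mono mult_right_mono) auto
      finally show ?case using h(2) by simp
    qed
  qed auto
  have "h (B.expectation (\<lambda>x. x * p + (1 - x) * q)) \<le> B.expectation (\<lambda>x. h (x * p + (1 - x) * q))"
    by (rule B.jensens_inequality[where I=UNIV]) (use int hint h(1) in auto)
  moreover have "B.expectation (\<lambda>x. x * p + (1 - x) * q) = (a * p + b * q) / (a + b)"
  proof -
    have "B.expectation (\<lambda>x. x * p + (1 - x) * q) = a / (a + b) * p + (1 - a / (a + b)) * q"
      using int by (simp add: mean B.prob_space[simplified])
    also have "1 - a / (a + b) = b / (a + b)" using ab by (simp add: field_simps)
    finally show ?thesis by (simp add: add_divide_distrib)
  qed
  ultimately show ?thesis
    using h(2) by (subst nn_integral_eq_integral[OF hint]) auto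
qed

text \<open>Condition on the sum \<open>t\<close> of the two variables: the conditional mean of
  \<open>c * x + v * (t - x)\<close> is \<open>(a * c + b * v) / (a + b) * t\<close>, so Jensen's
  inequality for the beta law of the share applies for each \<open>t\<close>.\<close>

lemma gamma_pair_convex_order:
  fixes h :: "real \<Rightarrow> real"
  assumes ab: "0 < a" "0 < b" and h: "convex_on UNIV h" "\<And>x. 0 \<le> h x"
  shows "(\<integral>\<^sup>+t. ennreal (h ((a * c + b * v) / (a + b) * t)) \<partial>gamma_measure (a + b))
    \<le> (\<integral>\<^sup>+x. (\<integral>\<^sup>+y. ennreal (h (c * x + v * y)) \<partial>gamma_measure b) \<partial>gamma_measure a)"
proof -
  have [measurable]: "h \<in> borel_measurable borel" by (rule convex_imp_borel_measurable[OF h(1)])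
  let ?g = "\<lambda>a x. ennreal (gamma_density a 1 x)"
  \<comment> \<open>The conditional inequality for a fixed sum \<open>t\<close>; the right-hand side
    is the convolution of the two densities, weighted by the test function.\<close>
  have inner: "?g (a + b) t * ennreal (h ((a * c + b * v) / (a + b) * t))
      \<le> (\<integral>\<^sup>+x. ?g a x * ?g b (t - x) * ennreal (h (c * x + v * (t - x))) \<partial>lborel)" for t
  proof (cases "0 < t")
    case True
    have "ennreal (h ((a * c + b * v) / (a + b) * t))
        = ennreal (h ((a * (c * t) + b * (v * t)) / (a + b)))"
      by (simp add: algebra_simps add_divide_distrib)
    also have "\<dots> \<le> (\<integral>\<^sup>+x. ennreal (h (x * (c * t) + (1 - x) * (v * t))) \<partial>beta_measure a b)"
      by (rule beta_jensen[OF ab h])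
    finally have "?g (a + b) t * ennreal (h ((a * c + b * v) / (a + b) * t))
        \<le> ?g (a + b) t * \<dots>"
      by (intro mult_left_mono) auto
    also have "\<dots> = (\<integral>\<^sup>+x. ennreal (t * gamma_density a 1 (t * x) * gamma_density b 1 (t - t * x))
        * ennreal (h (c * (t * x) + v * (t - t * x))) \<partial>lborel)"
    proof -
      have arg: "x * (c * t) + (1 - x) * (v * t) = c * (t * x) + v * (t - t * x)" for x
        by (simp add: algebra_simps)
      show ?thesis
        unfolding beta_measure_def gamma_density_beta[OF ab True] arg
        using ab
        by (subst nn_integral_density)
           (auto simp: ennreal_mult' gamma_density_nonneg mult.assoc nn_integral_cmult[symmetric]
             simp del: times_divide_eq_right intro!: nn_integral_cong)
    qed
    \<comment> \<open>Return from shares to values: the Jacobian \<open>t\<close> is what the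
      substitution of \<open>t * x\<close> by \<open>x\<close> absorbs.\<close>
    also have "\<dots> = ennreal \<bar>t\<bar> * (\<integral>\<^sup>+x. ?g a (0 + t * x) * ?g b (t - (0 + t * x)) * ennreal (h (c * (0 + t * x) + v * (t - (0 + t * x)))) \<partial>lborel)"
      using True ab
      by (subst nn_integral_cmult[symmetric])
         (auto simp: ennreal_mult' gamma_density_nonneg mult_ac intro!: nn_integral_cong)
    also have "\<dots> = (\<integral>\<^sup>+x. ?g a x * ?g b (t - x) * ennreal (h (c * x + v * (t - x))) \<partial>lborel)"
      using True by (subst nn_integral_real_affine[where c=t and t=0]) auto
    finally show ?thesis .
  qed (simp add: gamma_density_def)
  have "(\<integral>\<^sup>+t. ennreal (h ((a * c + b * v) / (a + b) * t)) \<partial>gamma_measure (a + b))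
      = (\<integral>\<^sup>+t. ?g (a + b) t * ennreal (h ((a * c + b * v) / (a + b) * t)) \<partial>lborel)"
    by (rule nn_integral_gamma_measure) measurable
  also have "\<dots> \<le> (\<integral>\<^sup>+t. \<integral>\<^sup>+x. ?g a x * ?g b (t - x) * ennreal (h (c * x + v * (t - x))) \<partial>lborel \<partial>lborel)"
    by (intro nn_integral_mono inner)
  also have "\<dots> = (\<integral>\<^sup>+x. \<integral>\<^sup>+t. ?g a x * ?g b (t - x) * ennreal (h (c * x + v * (t - x))) \<partial>lborel \<partial>lborel)"
    by (rule lborel_pair.Fubini') measurable
  also have "\<dots> = (\<integral>\<^sup>+x. ?g a x * (\<integral>\<^sup>+y. ?g b y * ennreal (h (c * x + v * y)) \<partial>lborel) \<partial>lborel)"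
  proof (rule nn_integral_cong)
    fix x :: real
    have "(\<integral>\<^sup>+t. ?g b (t - x) * ennreal (h (c * x + v * (t - x))) \<partial>lborel)
        = (\<integral>\<^sup>+y. ?g b y * ennreal (h (c * x + v * y)) \<partial>lborel)"
      by (subst nn_integral_real_affine[where c=1 and t=x]) auto
    then show "(\<integral>\<^sup>+t. ?g a x * ?g b (t - x) * ennreal (h (c * x + v * (t - x))) \<partial>lborel)
        = ?g a x * (\<integral>\<^sup>+y. ?g b y * ennreal (h (c * x + v * y)) \<partial>lborel)"
      by (simp add: nn_integral_cmult mult.assoc)
  qed
  also have "\<dots> = (\<integral>\<^sup>+x. (\<integral>\<^sup>+y. ennreal (h (c * x + v * y)) \<partial>gamma_measure b) \<partial>gamma_measure a)"
    by (simp add: nn_integral_gamma_measure)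
  finally show ?thesis .
qed

section \<open>Finite sums of independent gamma variables\<close>

lemma convex_on_translate:
  fixes h :: "real \<Rightarrow> real"
  assumes "convex_on UNIV h"
  shows "convex_on UNIV (\<lambda>x. h (x + y))"
proof (rule convex_onI)
  fix t x z :: real assume "0 < t" "t < 1"
  moreover have "(1 - t) *\<^sub>R x + t *\<^sub>R z + y = (1 - t) *\<^sub>R (x + y) + t *\<^sub>R (z + y)"
    by (simp add: algebra_simps)
  ultimately show "h ((1 - t) *\<^sub>R x + t *\<^sub>R z + y) \<le> (1 - t) * h (x + y) + t * h (z + y)"
    using convex_onD[OF assms, of t "x + y" "z + y"] by simp
qed simp

text \<open>The witness \<open>P\<close> is the law of the sum of independent variables
  \<open>v i * G i\<close>, built one convolution at a time. The factor in the comparison is the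
  mean of the \<open>v i\<close> with weights \<open>a i\<close>, which gives both sides the same
  mean.\<close>

lemma gamma_mixture_law:
  fixes a v :: "'i \<Rightarrow> real"
  assumes "finite I" "I \<noteq> {}" "\<And>i. i \<in> I \<Longrightarrow> 0 < a i" "\<And>i. i \<in> I \<Longrightarrow> 0 \<le> v i"
  shows "\<exists>P. prob_space P \<and> sets P = sets borel \<and> (AE x in P. 0 \<le> x) \<and>
    (\<forall>s\<ge>0. (\<integral>\<^sup>+x. ennreal (exp (- s * x)) \<partial>P) = ennreal (\<Prod>i\<in>I. (1 + s * v i) powr (- a i))) \<and>
    (\<forall>h. convex_on UNIV h \<longrightarrow> (\<forall>x. 0 \<le> h x) \<longrightarrow>
      (\<integral>\<^sup>+t. ennreal (h ((\<Sum>i\<in>I. a i * v i) / (\<Sum>i\<in>I. a i) * t)) \<partial>gamma_measure (\<Sum>i\<in>I. a i))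
        \<le> (\<integral>\<^sup>+x. ennreal (h x) \<partial>P))"
  using assms
proof (induction I rule: finite_ne_induct)
  case (singleton i)
  interpret G: prob_space "gamma_measure (a i)"
    using singleton by (intro prob_space_gamma_measure) simp
  let ?P = "distr (gamma_measure (a i)) borel (\<lambda>x. v i * x)"
  have "prob_space ?P" by (rule G.prob_space_distr) simp
  moreover have "AE x in ?P. 0 \<le> x"
    using AE_gamma_measure_pos[of "a i"] singleton
    by (subst AE_distr_iff) (auto elim!: eventually_mono)
  moreover have "(\<integral>\<^sup>+x. ennreal (exp (- s * x)) \<partial>?P) = ennreal ((1 + s * v i) powr (- a i))"
    if "0 \<le> s" for s
    using singleton laplace_gamma_measure[of "a i" "s * v i"] that
    by (simp add: nn_integral_distr mult.assoc)
  moreover have "(\<integral>\<^sup>+t. ennreal (h (v i * t)) \<partial>gamma_measure (a i)) \<le> (\<integral>\<^sup>+x. ennreal (h x) \<partial>?P)"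
    if "convex_on UNIV h" for h
    using convex_imp_borel_measurable[OF that] by (simp add: nn_integral_distr)
  moreover have "a i * v i / a i = v i" using singleton(1)[of i] by simp
  ultimately show ?case by (intro exI[of _ ?P]) auto
next
  case (insert i I)
  define A where "A = (\<Sum>i\<in>I. a i)"
  \<comment> \<open>With weights \<open>A\<close> and \<open>a i\<close>, the mean of
    \<open>c\<close> and \<open>v i\<close> is the weighted mean over \<open>insert i I\<close>;
    this matches the form of the two-variable inequality.\<close>
  define c where "c = (\<Sum>i\<in>I. a i * v i) / A"
  have A: "0 < A" unfolding A_def using insert by (intro sum_pos) auto
  have ai: "0 < a i" and vi: "0 \<le> v i" using insert by auto
  obtain P where P: "prob_space P" and sP [measurable_cong, simp]: "sets P = sets borel"
    and P0: "AE x in P. 0 \<le> x"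
    and PL: "\<And>s. 0 \<le> s \<Longrightarrow> (\<integral>\<^sup>+x. ennreal (exp (- s * x)) \<partial>P) = ennreal (\<Prod>i\<in>I. (1 + s * v i) powr (- a i))"
    and PC: "\<And>h. convex_on UNIV h \<Longrightarrow> (\<And>x. 0 \<le> h x) \<Longrightarrow>
      (\<integral>\<^sup>+t. ennreal (h (c * t)) \<partial>gamma_measure A) \<le> (\<integral>\<^sup>+x. ennreal (h x) \<partial>P)"
    using insert unfolding A_def c_def by auto
  let ?G = "gamma_measure (a i)"
  interpret P: prob_space P by (rule P)
  interpret G: prob_space ?G using ai by (rule prob_space_gamma_measure)
  interpret GA: prob_space "gamma_measure A" using A by (rule prob_space_gamma_measure)
  interpret PG: pair_prob_space P ?G ..
  interpret GG: pair_prob_space "gamma_measure A" ?G ..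
  have sumA: "(\<Sum>i\<in>insert i I. a i) = A + a i"
    using insert.hyps by (simp add: A_def add.commute)
  have sumv: "(\<Sum>i\<in>insert i I. a i * v i) = A * c + a i * v i"
    using insert.hyps A by (simp add: c_def add.commute)
  \<comment> \<open>The convolution of \<open>P\<close> with the law of \<open>v i\<close> times a
    gamma variable.\<close>
  let ?Q = "distr (P \<Otimes>\<^sub>M ?G) borel (\<lambda>(x, y). x + v i * y)"
  have nnQ: "(\<integral>\<^sup>+z. f z \<partial>?Q) = (\<integral>\<^sup>+y. \<integral>\<^sup>+x. f (x + v i * y) \<partial>P \<partial>?G)"
    if [measurable]: "f \<in> borel_measurable borel" for f
    by (subst nn_integral_distr) (auto simp: PG.nn_integral_snd[symmetric] split_beta')
  have "prob_space ?Q" by (rule PG.prob_space_distr) measurable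
  moreover have "AE z in ?Q. 0 \<le> z"
  proof -
    have "AE y in ?G. AE x in P. 0 \<le> x + v i * y"
      using AE_gamma_measure_pos[of "a i"]
    proof eventually_elim
      case (elim y)
      then show ?case using P0 vi by (auto elim!: eventually_mono)
    qed
    then have "(\<integral>\<^sup>+z. indicator {..<0} z \<partial>?Q) = 0"
      by (subst nnQ)
         (auto simp: nn_integral_0_iff_AE indicator_def elim!: eventually_mono)
    then show ?thesis
      by (subst (asm) nn_integral_0_iff_AE) (auto elim!: eventually_mono simp: indicator_def split: if_splits)
  qed
  moreover have "(\<integral>\<^sup>+x. ennreal (exp (- s * x)) \<partial>?Q)
      = ennreal (\<Prod>i\<in>insert i I. (1 + s * v i) powr (- a i))" if s: "0 \<le> s" for s
  proof -
    have "(\<integral>\<^sup>+x. ennreal (exp (- s * x)) \<partial>?Q)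
      = (\<integral>\<^sup>+y. \<integral>\<^sup>+x. ennreal (exp (- (s * v i) * y)) * ennreal (exp (- s * x)) \<partial>P \<partial>?G)"
      by (subst nnQ) (auto simp: ennreal_mult'[symmetric] exp_add[symmetric] algebra_simps)
    also have "\<dots> = ennreal ((1 + s * v i) powr (- a i)) * ennreal (\<Prod>i\<in>I. (1 + s * v i) powr (- a i))"
      using PL[OF s] laplace_gamma_measure[OF ai, of "s * v i"] s vi
      by (simp add: nn_integral_cmult nn_integral_multc)
    also have "\<dots> = ennreal (\<Prod>i\<in>insert i I. (1 + s * v i) powr (- a i))"
      using insert.hyps by (simp add: ennreal_mult')
    finally show ?thesis .
  qed
  moreover have "(\<integral>\<^sup>+t. ennreal (h ((A * c + a i * v i) / (A + a i) * t)) \<partial>gamma_measure (A + a i))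
      \<le> (\<integral>\<^sup>+x. ennreal (h x) \<partial>?Q)" if h: "convex_on UNIV h" "\<And>x. 0 \<le> h x" for h
  proof -
    have [measurable]: "h \<in> borel_measurable borel" by (rule convex_imp_borel_measurable[OF h(1)])
    have "(\<integral>\<^sup>+t. ennreal (h ((A * c + a i * v i) / (A + a i) * t)) \<partial>gamma_measure (A + a i))
      \<le> (\<integral>\<^sup>+x. \<integral>\<^sup>+y. ennreal (h (c * x + v i * y)) \<partial>?G \<partial>gamma_measure A)"
      by (rule gamma_pair_convex_order[OF A ai h])
    also have "\<dots> = (\<integral>\<^sup>+y. \<integral>\<^sup>+x. ennreal (h (c * x + v i * y)) \<partial>gamma_measure A \<partial>?G)"
      by (rule GG.Fubini'[symmetric]) measurable
    \<comment> \<open>For frozen \<open>y\<close> the function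
      \<open>x \<mapsto> h (x + v i * y)\<close> is again convex and nonnegative, so the induction
      hypothesis replaces the single variable \<open>c * x\<close> by \<open>P\<close>.\<close>
    also have "\<dots> \<le> (\<integral>\<^sup>+y. \<integral>\<^sup>+x. ennreal (h (x + v i * y)) \<partial>P \<partial>?G)"
      using h by (intro nn_integral_mono PC[of "\<lambda>x. h (x + v i * y)" for y] convex_on_translate) auto
    also have "\<dots> = (\<integral>\<^sup>+x. ennreal (h x) \<partial>?Q)"
      by (rule nnQ[symmetric]) measurable
    finally show ?thesis .
  qed
  ultimately show ?case
    unfolding sumA sumv by (intro exI[of _ ?Q]) auto
qed

section \<open>Truncation of convex functions\<close>

lemma convex_on_subgradient:
  fixes g :: "real \<Rightarrow> real"
  assumes "convex_on UNIV g"
  obtains m where "\<And>y. g k + m * (y - k) \<le> g y"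
  using convex_le_Inf_differential[OF assms, of k] by auto

text \<open>The excess of \<open>g\<close> over its tangent at \<open>k\<close> is convex and decreasing left of \<open>k\<close>, hence stays
  convex when composed with the concave function \<open>min x k\<close>.\<close>

lemma convex_on_truncated:
  fixes g :: "real \<Rightarrow> real"
  assumes g: "convex_on UNIV g" and m: "\<And>y. g k + m * (y - k) \<le> g y"
  shows "convex_on UNIV (\<lambda>x. g (min x k) - (g k + m * (min x k - k)))"
proof -
  define d where "d x = g x - (g k + m * (x - k))" for x
  have d0: "0 \<le> d x" for x using m[of x] by (simp add: d_def)
  have dconv: "d ((1 - t) * x + t * y) \<le> (1 - t) * d x + t * d y" if "0 \<le> t" "t \<le> 1" for t x y
  proof -
    have "g ((1 - t) * x + t * y) \<le> (1 - t) * g x + t * g y"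
      using convex_onD[OF g, of t x y] that by simp
    then show ?thesis by (simp add: d_def algebra_simps)
  qed
  have anti: "d y \<le> d x" if "x \<le> y" "y \<le> k" for x y
  proof (cases "x = k")
    case False
    \<comment> \<open>\<open>t\<close> is the weight that places \<open>y\<close> between
      \<open>x\<close> and \<open>k\<close>; since \<open>d k = 0\<close>, convexity leaves
      \<open>(1 - t) * d x\<close>.\<close>
    define t where "t = (y - x) / (k - x)"
    have t: "0 \<le> t" "t \<le> 1" using that False by (auto simp: t_def field_simps)
    have "t * (k - x) = y - x" using that False by (simp add: t_def)
    then have "y = (1 - t) * x + t * k" by (simp add: algebra_simps)
    then have "d y \<le> (1 - t) * d x + t * d k" using dconv[OF t] by metis
    also have "d k = 0" by (simp add: d_def)
    finally show ?thesis using t d0[of x] mult_right_mono[of "1 - t" 1 "d x"] by simp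
  qed (use that in auto)
  have "convex_on UNIV (\<lambda>x. d (min x k))"
  proof (rule convex_onI)
    fix t x y :: real assume t: "0 < t" "t < 1"
    \<comment> \<open>Concavity of \<open>min x k\<close>, obtained by bounding the left side by
      each argument of the outer minimum.\<close>
    have "(1 - t) * min x k + t * min y k \<le> (1 - t) * x + t * y"
      using t by (intro add_mono mult_left_mono) auto
    moreover have "(1 - t) * min x k + t * min y k \<le> (1 - t) * k + t * k"
      using t by (intro add_mono mult_left_mono) auto
    ultimately have "(1 - t) * min x k + t * min y k \<le> min ((1 - t) * x + t * y) k"
      by (simp add: algebra_simps)
    then have "d (min ((1 - t) * x + t * y) k) \<le> d ((1 - t) * min x k + t * min y k)"
      by (rule anti) simp
    also have "\<dots> \<le> (1 - t) * d (min x k) + t * d (min y k)"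
      using t by (intro dconv) auto
    finally show "d (min ((1 - t) *\<^sub>R x + t *\<^sub>R y) k) \<le> (1 - t) * d (min x k) + t * d (min y k)"
      by simp
  qed simp
  then show ?thesis by (simp add: d_def)
qed

section \<open>Passage to the limit\<close>

text \<open>Compactness controls \<open>h\<close> on \<open>[0, k]\<close>. Only nonnegative
  arguments are bounded: to the left of 0 a convex \<open>h\<close> may grow, but the laws
  considered live on the half-line.\<close>

lemma vanishing_bounded:
  fixes h :: "real \<Rightarrow> real"
  assumes cont: "continuous_on UNIV h" and van: "\<And>x. k \<le> x \<Longrightarrow> h x = 0"
  obtains C where "\<And>x. 0 \<le> x \<Longrightarrow> norm (h x) \<le> C"
proof -
  have "compact (h ` {0..k})"
    using cont by (intro compact_continuous_image) (auto intro: continuous_on_subset)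
  then obtain C where C: "\<And>x. x \<in> {0..k} \<Longrightarrow> norm (h x) \<le> C"
    by (metis bounded_iff compact_imp_bounded imageI)
  show ?thesis
  \<comment> \<open>If \<open>k < 0\<close>, the interval \<open>{0..k}\<close> is empty and
    \<open>C\<close> may be negative, hence the maximum with 0.\<close>
  proof (rule that[of "max C 0"])
    fix x :: real assume "0 \<le> x"
    then show "norm (h x) \<le> max C 0"
      using C[of x] van[of x] by (cases "x \<le> k") auto
  qed
qed

text \<open>Substituting \<open>t = exp (-x)\<close> turns \<open>h\<close> into a continuous function on \<open>[0, 1]\<close>, to which
  the Weierstrass theorem applies.\<close>

lemma exp_polynomial_approx:
  fixes h :: "real \<Rightarrow> real"
  assumes cont: "continuous_on UNIV h" and van: "\<And>x. k \<le> x \<Longrightarrow> h x = 0" and e: "0 < e"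
  shows "\<exists>a n. \<forall>x\<ge>0. \<bar>h x - (\<Sum>i\<le>n. a i * exp (- real i * x))\<bar> < e"
proof -
  \<comment> \<open>The cut at \<open>exp (- k)\<close> keeps \<open>ln\<close> away from 0. The
    branches agree there because \<open>h k = 0\<close>, and \<open>q (exp (- x)) = h x\<close>
    holds beyond \<open>k\<close> since both sides vanish.\<close>
  define q where "q t = (if t \<le> exp (- k) then 0 else h (- ln t))" for t
  have "continuous_on ({..exp (- k)} \<union> {exp (- k)..}) q"
    unfolding q_def
  proof (rule continuous_on_If)
    show "continuous_on {exp (- k)..} (\<lambda>t. h (- ln t))"
    proof (rule continuous_on_compose2[OF cont])
      have "t \<noteq> 0" if "exp (- k) \<le> t" for t
        using that exp_gt_zero[of "- k"] by linarith
      then show "continuous_on {exp (- k)..} (\<lambda>t. - ln t)"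
        by (intro continuous_intros) auto
    qed simp
  qed (auto simp: van intro: antisym)
  then have "continuous_on {0..1} q" by (rule continuous_on_subset) auto
  then obtain p where p: "real_polynomial_function p" "\<And>t. t \<in> {0..1} \<Longrightarrow> \<bar>q t - p t\<bar> < e"
    using Stone_Weierstrass_real_polynomial_function[of "{0..1}" q e] e by auto
  then obtain a n where pn: "p = (\<lambda>x. \<Sum>i\<le>n. a i * x ^ i)"
    using real_polynomial_function_iff_sum by auto
  show ?thesis
  proof (intro exI allI impI)
    fix x :: real assume x: "0 \<le> x"
    have "q (exp (- x)) = h x" using van by (auto simp: q_def)
    moreover have "p (exp (- x)) = (\<Sum>i\<le>n. a i * exp (- real i * x))"
      unfolding pn by (simp add: exp_of_nat_mult[symmetric])
    ultimately show "\<bar>h x - (\<Sum>i\<le>n. a i * exp (- real i * x))\<bar> < e"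
      using p(2)[of "exp (- x)"] x by simp
  qed
qed

text \<open>Convergence of the transforms at the integers gives convergence for polynomials in
  \<open>exp (- x)\<close>, which approximate \<open>h\<close> uniformly on the half-line carrying
  all the laws.\<close>

lemma laplace_continuity:
  fixes h :: "real \<Rightarrow> real" and P :: "nat \<Rightarrow> real measure"
  assumes P: "\<And>n. prob_space (P n)" "\<And>n. sets (P n) = sets borel" "\<And>n. AE x in P n. 0 \<le> x"
    and Q: "prob_space Q" "sets Q = sets borel" "AE x in Q. 0 \<le> x"
    and lim: "\<And>s. 0 \<le> s \<Longrightarrow> (\<lambda>n. \<integral>x. exp (- s * x) \<partial>P n) \<longlonglongrightarrow> (\<integral>x. exp (- s * x) \<partial>Q)"
    and cont: "continuous_on UNIV h" and van: "\<And>x. k \<le> x \<Longrightarrow> h x = 0"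
  shows "(\<lambda>n. \<integral>x. h x \<partial>P n) \<longlonglongrightarrow> (\<integral>x. h x \<partial>Q)"
proof (rule LIMSEQ_I)
  fix r :: real assume r: "0 < r"
  \<comment> \<open>Three errors of size \<open>r / 4\<close> add up: the approximation under
    \<open>P n\<close>, the approximation under \<open>Q\<close>, and the distance between the two
    approximating sums.\<close>
  obtain a m where ap: "\<And>x. 0 \<le> x \<Longrightarrow> \<bar>h x - (\<Sum>i\<le>m. a i * exp (- real i * x))\<bar> < r / 4"
    using exp_polynomial_approx[of h k "r / 4"] cont van r by (auto simp del: mult_minus_left)
  have [measurable]: "h \<in> borel_measurable borel"
    using cont by (rule borel_measurable_continuous_onI)
  obtain C where C: "\<And>x. 0 \<le> x \<Longrightarrow> norm (h x) \<le> C"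
    using vanishing_bounded[OF cont van] by auto
  have near: "\<bar>(\<integral>x. h x \<partial>R) - (\<Sum>i\<le>m. a i * (\<integral>x. exp (- real i * x) \<partial>R))\<bar> \<le> r / 4"
    if R: "prob_space R" and sR [measurable_cong]: "sets R = sets borel" and R0: "AE x in R. 0 \<le> x" for R
  proof -
    interpret R: prob_space R by (rule R)
    have ie: "integrable R (\<lambda>x. exp (- real i * x))" for i
      using R0 by (intro R.integrable_const_bound[where B=1]) (auto elim!: eventually_mono)
    have ih: "integrable R h"
      using R0 C by (intro R.integrable_const_bound[where B=C]) (auto elim!: eventually_mono)
    have isum: "integrable R (\<lambda>x. \<Sum>i\<le>m. a i * exp (- real i * x))"
      using ie by auto
    have "\<bar>(\<integral>x. h x \<partial>R) - (\<Sum>i\<le>m. a i * (\<integral>x. exp (- real i * x) \<partial>R))\<bar>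
      = \<bar>\<integral>x. h x - (\<Sum>i\<le>m. a i * exp (- real i * x)) \<partial>R\<bar>"
      using ih ie isum by simp
    also have "\<dots> \<le> (\<integral>x. \<bar>h x - (\<Sum>i\<le>m. a i * exp (- real i * x))\<bar> \<partial>R)"
      by (rule integral_abs_bound)
    also have "\<dots> \<le> (\<integral>x. r / 4 \<partial>R)"
    proof (rule integral_mono_AE)
      show "AE x in R. \<bar>h x - (\<Sum>i\<le>m. a i * exp (- real i * x))\<bar> \<le> r / 4"
        using R0 by eventually_elim (rule less_imp_le[OF ap])
    qed (use ih isum in auto)
    also have "\<dots> = r / 4" by (simp add: R.prob_space)
    finally show ?thesis .
  qed
  have "(\<lambda>n. \<Sum>i\<le>m. a i * (\<integral>x. exp (- real i * x) \<partial>P n)) \<longlonglongrightarrow> (\<Sum>i\<le>m. a i * (\<integral>x. exp (- real i * x) \<partial>Q))"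
    by (intro tendsto_intros lim) simp
  from LIMSEQ_D[OF this, of "r / 4"] r
  obtain N where N: "\<And>n. N \<le> n \<Longrightarrow> \<bar>(\<Sum>i\<le>m. a i * (\<integral>x. exp (- real i * x) \<partial>P n)) - (\<Sum>i\<le>m. a i * (\<integral>x. exp (- real i * x) \<partial>Q))\<bar> < r / 4"
    by auto
  show "\<exists>N. \<forall>n\<ge>N. norm ((\<integral>x. h x \<partial>P n) - (\<integral>x. h x \<partial>Q)) < r"
  proof (intro exI allI impI)
    fix n assume "N \<le> n"
    with near[OF P, of n] near[OF Q] N[of n] r
    show "norm ((\<integral>x. h x \<partial>P n) - (\<integral>x. h x \<partial>Q)) < r"
      unfolding real_norm_def by linarith
  qed
qed

text \<open>Values taken on null sets are dropped because the masses will serve as gamma shapes,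
  which must be positive.\<close>

lemma (in finite_measure) integral_simple_comp:
  fixes f \<phi> :: "_ \<Rightarrow> real"
  assumes f: "simple_function M f"
  shows "(\<integral>x. \<phi> (f x) \<partial>M)
    = (\<Sum>y\<in>{y \<in> f ` space M. 0 < measure M (f -` {y} \<inter> space M)}. measure M (f -` {y} \<inter> space M) * \<phi> y)"
proof -
  have fin: "finite (f ` space M)" using f by (rule simple_functionD)
  have sets [measurable]: "f -` {y} \<inter> space M \<in> sets M" for y
    using f by (rule simple_functionD)
  have "(\<integral>x. \<phi> (f x) \<partial>M) = (\<integral>x. (\<Sum>y\<in>f ` space M. \<phi> y * indicator (f -` {y} \<inter> space M) x) \<partial>M)"
  proof (rule Bochner_Integration.integral_cong[OF refl])
    fix x assume x: "x \<in> space M"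
    have "(\<Sum>y\<in>f ` space M. \<phi> y * indicator (f -` {y} \<inter> space M) x)
        = (\<Sum>y\<in>f ` space M. if y = f x then \<phi> y else 0)"
      using x by (intro sum.cong) (auto simp: indicator_def)
    then show "\<phi> (f x) = (\<Sum>y\<in>f ` space M. \<phi> y * indicator (f -` {y} \<inter> space M) x)"
      using x fin by simp
  qed
  also have "\<dots> = (\<Sum>y\<in>f ` space M. measure M (f -` {y} \<inter> space M) * \<phi> y)"
    using emeasure_finite
    by (subst Bochner_Integration.integral_sum) (auto simp: mult.commute top.not_eq_extremum less_top[symmetric])
  also have "\<dots> = (\<Sum>y\<in>{y \<in> f ` space M. 0 < measure M (f -` {y} \<inter> space M)}. measure M (f -` {y} \<inter> space M) * \<phi> y)"
    using fin by (intro sum.mono_neutral_right) (auto simp: zero_less_measure_iff measure_eq_0_null_sets not_less measure_le_0_iff)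
  finally show ?thesis .
qed

section \<open>Thorin measures of GGCs with mean one\<close>

lemma thorin_measure_space: "GGC M X \<mu> \<Longrightarrow> space \<mu> = {0<..}"
  unfolding GGC_def using sets_eq_imp_space_eq[of \<mu> "restrict_space borel {0<..}"]
  by (simp add: space_restrict_space)

lemma thorin_measurable:
  assumes "GGC M X \<mu>" "f \<in> borel_measurable borel"
  shows "f \<in> borel_measurable \<mu>"
proof -
  have "sets \<mu> = sets (restrict_space borel {0<..})" using assms(1) by (simp add: GGC_def)
  then show ?thesis
    using measurable_restrict_space1[OF assms(2)] by (simp cong: measurable_cong_sets)
qed

text \<open>Compare the slopes at \<open>s = 0\<close> of the two sides of the transform identity:
  one is governed by the mean of \<open>X\<close>, the other by the integral of
  \<open>1 / u\<close>. The slopes are taken along the null sequence \<open>r n\<close>.\<close>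

lemma thorin_mean:
  assumes M: "prob_space M" and ggc: "GGC M X \<mu>" and mean: "has_bochner_integral M X 1"
  shows "has_bochner_integral \<mu> (\<lambda>u. 1 / u) 1"
proof -
  interpret M: prob_space M by (rule M)
  note space = thorin_measure_space[OF ggc]
  have [measurable]: "X \<in> borel_measurable M" using ggc by (simp add: GGC_def)
  have X0: "AE \<omega> in M. 0 \<le> X \<omega>" using ggc by (simp add: GGC_def)
  have iX: "integrable M X" and EX: "(\<integral>\<omega>. X \<omega> \<partial>M) = 1"
    using mean by (auto simp: has_bochner_integral_iff)
  define r where "r n = 1 / real (Suc n)" for n
  have r0: "0 < r n" for n by (simp add: r_def)
  define p where "p n = (\<integral>u. ln (1 + r n / u) \<partial>\<mu>)" for n
  have ilog: "integrable \<mu> (\<lambda>u. ln (1 + r n / u))" for n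
    using ggc r0[of n] by (auto simp: GGC_def)
  have transform: "(\<integral>\<omega>. exp (- r n * X \<omega>) \<partial>M) = exp (- p n)" for n
    using ggc r0[of n] by (auto simp: GGC_def p_def)
  have p0: "0 \<le> p n" for n
    unfolding p_def using r0[of n] by (intro integral_nonneg_AE AE_I2) (auto simp: space)
  have wlim: "(\<lambda>n. (1 - exp (- p n)) / r n) \<longlonglongrightarrow> 1"
  proof -
    \<comment> \<open>The inequality \<open>1 - exp (- y) \<le> y\<close> makes \<open>X\<close>
      itself a majorant of the difference quotients.\<close>
    have "(\<lambda>n. \<integral>\<omega>. (1 - exp (- r n * X \<omega>)) / r n \<partial>M) \<longlonglongrightarrow> (\<integral>\<omega>. X \<omega> \<partial>M)"
    proof (rule integral_dominated_convergence[where w=X])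
      show "AE \<omega> in M. (\<lambda>n. (1 - exp (- r n * X \<omega>)) / r n) \<longlonglongrightarrow> X \<omega>"
      proof (rule AE_I2)
        fix \<omega>
        show "(\<lambda>n. (1 - exp (- r n * X \<omega>)) / r n) \<longlonglongrightarrow> X \<omega>"
          unfolding r_def by real_asymp
      qed
      show "AE \<omega> in M. norm ((1 - exp (- r n * X \<omega>)) / r n) \<le> X \<omega>" for n
        using X0
      proof eventually_elim
        case (elim \<omega>)
        have "exp (- r n * X \<omega>) \<le> 1" using elim r0[of n] by simp
        moreover have "1 - exp (- r n * X \<omega>) \<le> X \<omega> * r n"
          using exp_ge_add_one_self[of "- r n * X \<omega>"] by (simp add: mult.commute)
        ultimately show ?case using r0[of n] by (simp add: pos_divide_le_eq)
      qed
    qed (use iX in auto)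
    moreover have "(\<integral>\<omega>. (1 - exp (- r n * X \<omega>)) / r n \<partial>M) = (1 - exp (- p n)) / r n" for n
    proof -
      have "integrable M (\<lambda>\<omega>. exp (- r n * X \<omega>))"
        using X0 r0[of n] by (intro M.integrable_const_bound[where B=1]) (auto elim!: eventually_mono)
      then show ?thesis using transform[of n] by (simp add: M.prob_space)
    qed
    ultimately show ?thesis by (simp only: EX)
  qed
  have rlim: "r \<longlonglongrightarrow> 0" unfolding r_def by real_asymp
  \<comment> \<open>Multiplying the convergent quotient by \<open>r n\<close> shows that
    \<open>1 - exp (- p n)\<close> tends to 0.\<close>
  have "(\<lambda>n. 1 - (1 - exp (- p n)) / r n * r n) \<longlonglongrightarrow> 1 - 1 * 0"
    by (intro tendsto_intros wlim rlim)
  then have elim: "(\<lambda>n. exp (- p n)) \<longlonglongrightarrow> 1"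
    using r0 by (simp add: less_imp_neq[THEN not_sym])
  \<comment> \<open>Squeeze by \<open>1 - exp (- p) \<le> p \<le> exp p - 1\<close>, where
    \<open>exp p - 1\<close> is \<open>(1 - exp (- p)) / exp (- p)\<close>.\<close>
  have plim: "(\<lambda>n. p n / r n) \<longlonglongrightarrow> 1"
  proof (rule tendsto_sandwich[OF _ _ wlim])
    show "(\<lambda>n. (1 - exp (- p n)) / r n * inverse (exp (- p n))) \<longlonglongrightarrow> 1"
      using tendsto_mult[OF wlim tendsto_inverse[OF elim]] by simp
    show "\<forall>\<^sub>F n in sequentially. (1 - exp (- p n)) / r n \<le> p n / r n"
    proof (intro always_eventually allI divide_right_mono)
      show "1 - exp (- p n) \<le> p n" for n using exp_ge_add_one_self[of "- p n"] by simp
    qed (use r0 less_imp_le in auto)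
    show "\<forall>\<^sub>F n in sequentially. p n / r n \<le> (1 - exp (- p n)) / r n * inverse (exp (- p n))"
    proof (intro always_eventually allI)
      fix n
      have "(1 - exp (- p n)) * inverse (exp (- p n)) = exp (p n) - 1"
        by (simp add: exp_minus algebra_simps)
      then have "p n \<le> (1 - exp (- p n)) * inverse (exp (- p n))"
        using exp_ge_add_one_self[of "p n"] by linarith
      from divide_right_mono[OF this, of "r n"] r0[of n]
      show "p n / r n \<le> (1 - exp (- p n)) / r n * inverse (exp (- p n))" by simp
    qed
  qed
  have ptw: "(\<lambda>n. ln (1 + r n / u) / r n) \<longlonglongrightarrow> 1 / u" if "0 < u" for u
  proof -
    have "(\<lambda>n. ln (1 + r n / u) / r n) \<longlonglongrightarrow> inverse u"
      unfolding r_def using that by real_asymp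
    then show ?thesis by (simp only: inverse_eq_divide)
  qed
  have bound: "0 \<le> ln (1 + r n / u) / r n \<and> ln (1 + r n / u) / r n \<le> 1 / u" if "0 < u" for n u
  proof -
    have "ln (1 + r n / u) \<le> r n / u"
      using that r0[of n] by (intro ln_add_one_self_le_self) auto
    then show ?thesis using that r0[of n] by (simp add: field_simps)
  qed
  have [measurable]: "(\<lambda>u. 1 / u) \<in> borel_measurable \<mu>"
    by (rule thorin_measurable[OF ggc]) simp
  have [measurable]: "(\<lambda>u. ln (1 + r n / u) / r n) \<in> borel_measurable \<mu>" for n
    using ilog[of n] by auto
  \<comment> \<open>Fatou's lemma first bounds the integral of \<open>1 / u\<close>; once
    integrable, \<open>1 / u\<close> is the majorant with which dominated convergence identifies its
    integral as 1.\<close>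
  have "(\<integral>\<^sup>+u. ennreal (1 / u) \<partial>\<mu>) = (\<integral>\<^sup>+u. liminf (\<lambda>n. ennreal (ln (1 + r n / u) / r n)) \<partial>\<mu>)"
  proof (rule nn_integral_cong)
    fix u assume "u \<in> space \<mu>"
    then have "(\<lambda>n. ennreal (ln (1 + r n / u) / r n)) \<longlonglongrightarrow> ennreal (1 / u)"
      using ptw[of u] by (auto simp: space intro: tendsto_ennrealI)
    then show "ennreal (1 / u) = liminf (\<lambda>n. ennreal (ln (1 + r n / u) / r n))"
      by (intro lim_imp_Liminf[symmetric]) auto
  qed
  also have "\<dots> \<le> liminf (\<lambda>n. \<integral>\<^sup>+u. ennreal (ln (1 + r n / u) / r n) \<partial>\<mu>)"
    by (rule nn_integral_liminf) auto
  also have "(\<lambda>n. \<integral>\<^sup>+u. ennreal (ln (1 + r n / u) / r n) \<partial>\<mu>) = (\<lambda>n. ennreal (p n / r n))"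
  proof
    fix n
    have "(\<integral>\<^sup>+u. ennreal (ln (1 + r n / u) / r n) \<partial>\<mu>) = ennreal (\<integral>u. ln (1 + r n / u) / r n \<partial>\<mu>)"
      using bound by (intro nn_integral_eq_integral AE_I2) (auto simp: space ilog)
    then show "(\<integral>\<^sup>+u. ennreal (ln (1 + r n / u) / r n) \<partial>\<mu>) = ennreal (p n / r n)"
      by (simp add: p_def)
  qed
  also have "liminf (\<lambda>n. ennreal (p n / r n)) = ennreal 1"
    using plim by (intro lim_imp_Liminf tendsto_ennrealI) auto
  finally have "(\<integral>\<^sup>+u. ennreal (1 / u) \<partial>\<mu>) \<le> 1" by simp
  then have fin: "(\<integral>\<^sup>+u. ennreal (1 / u) \<partial>\<mu>) < \<infinity>"
    by (metis ennreal_one_less_top infinity_ennreal_def le_less_trans)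
  have int: "integrable \<mu> (\<lambda>u. 1 / u)"
    using fin by (intro integrableI_nonneg AE_I2) (auto simp: space)
  have "(\<lambda>n. \<integral>u. ln (1 + r n / u) / r n \<partial>\<mu>) \<longlonglongrightarrow> (\<integral>u. 1 / u \<partial>\<mu>)"
  proof (rule integral_dominated_convergence[where w="\<lambda>u. 1 / u"])
    show "AE u in \<mu>. norm (ln (1 + r n / u) / r n) \<le> 1 / u" for n
    proof (rule AE_I2)
      fix u assume "u \<in> space \<mu>"
      then show "norm (ln (1 + r n / u) / r n) \<le> 1 / u"
        using bound[of u n] unfolding real_norm_def by (subst abs_of_nonneg) (simp_all add: space)
    qed
  qed (use int ptw in \<open>auto simp: space intro!: AE_I2\<close>)
  then have "(\<lambda>n. p n / r n) \<longlonglongrightarrow> (\<integral>u. 1 / u \<partial>\<mu>)" by (simp add: p_def)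
  from LIMSEQ_unique[OF this plim] int show ?thesis by (simp add: has_bochner_integral_iff)
qed

text \<open>Replacing \<open>1 / u\<close> by simple functions \<open>f i\<close> yields finite
  gamma sums with laws \<open>P i\<close>, to which the finite comparison applies. Both sides
  converge: the laws through their Laplace transforms, the single gamma variable through its scale
  \<open>c i\<close>.\<close>

lemma convex_truncated_order:
  fixes X :: "'a \<Rightarrow> real" and h :: "real \<Rightarrow> real"
  assumes M: "prob_space M" and ggc: "GGC M X \<mu>" and mass: "thorin_mass \<mu> = ennreal D"
    and mean: "has_bochner_integral M X 1"
    and h: "convex_on UNIV h" "\<And>x. 0 \<le> h x" and van: "\<And>x. k \<le> x \<Longrightarrow> h x = 0"
  shows "(\<integral>t. h (t / D) \<partial>gamma_measure D) \<le> (\<integral>\<omega>. h (X \<omega>) \<partial>M)"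
proof -
  interpret M: prob_space M by (rule M)
  note space = thorin_measure_space[OF ggc]
  have [measurable]: "X \<in> borel_measurable M" and X0: "AE \<omega> in M. 0 \<le> X \<omega>"
    using ggc by (auto simp: GGC_def)
  have emD: "emeasure \<mu> (space \<mu>) = ennreal D"
    using mass by (simp add: thorin_mass_def)
  \<comment> \<open>For \<open>D \<le> 0\<close> the value \<open>ennreal D\<close> would be 0,
    contradicting that the Thorin measure is nonzero.\<close>
  then have D: "0 < D"
    using ggc by (auto simp: GGC_def not_le[symmetric] ennreal_neg)
  interpret mu: finite_measure \<mu>
    by standard (simp add: emD)
  have mD: "measure \<mu> (space \<mu>) = D" using emD D by (simp add: measure_def)
  interpret G: prob_space "gamma_measure D" using D by (rule prob_space_gamma_measure)
  have cont: "continuous_on UNIV h" using h(1) by (rule convex_on_continuous[OF open_UNIV])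
  have [measurable]: "h \<in> borel_measurable borel" by (rule convex_imp_borel_measurable[OF h(1)])
  obtain C where C: "\<And>x. 0 \<le> x \<Longrightarrow> norm (h x) \<le> C"
    using vanishing_bounded[OF cont van] by auto
  have vmean: "has_bochner_integral \<mu> (\<lambda>u. 1 / u) 1" by (rule thorin_mean[OF M ggc mean])
  \<comment> \<open>Approximation by nonnegative simple functions asks for a function that is
    nonnegative on all reals; on the half-line the maximum equals \<open>1 / u\<close>.\<close>
  have "(\<lambda>u. max 0 (1 / u)) \<in> borel_measurable \<mu>"
    by (rule thorin_measurable[OF ggc]) simp
  from borel_measurable_implies_simple_function_sequence_real[OF this]
  obtain f where f: "incseq f" "\<And>i. simple_function \<mu> (f i)" "\<And>u. bdd_above (range (\<lambda>i. f i u))"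
    "\<And>i u. 0 \<le> f i u" "(\<lambda>u. max 0 (1 / u)) = (SUP i. f i)"
    by auto
  have fm [measurable]: "f i \<in> borel_measurable \<mu>" for i
    using f(2) by (rule borel_measurable_simple_function)
  have fsup: "(SUP i. f i u) = 1 / u" if "u \<in> space \<mu>" for u
    using fun_cong[OF f(5), of u] that by (simp add: space image_comp)
  have fle: "f i u \<le> 1 / u" if "u \<in> space \<mu>" for i u
    using cSUP_upper[OF UNIV_I f(3), of i u] fsup[OF that] by simp
  have flim: "(\<lambda>i. f i u) \<longlonglongrightarrow> 1 / u" if "u \<in> space \<mu>" for u
    unfolding fsup[OF that, symmetric]
    by (rule LIMSEQ_incseq_SUP[OF f(3)]) (use f(1) in \<open>auto simp: incseq_def le_fun_def\<close>)
  \<comment> \<open>A value \<open>y\<close> of \<open>f i\<close> is the scale of one gamma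
    summand, and the mass \<open>m i y\<close> of its level set is the shape.\<close>
  define m where "m i y = measure \<mu> (f i -` {y} \<inter> space \<mu>)" for i y
  define I where "I i = {y \<in> f i ` space \<mu>. 0 < m i y}" for i
  have comp: "(\<integral>u. \<phi> (f i u) \<partial>\<mu>) = (\<Sum>y\<in>I i. m i y * \<phi> y)" for \<phi> i
    unfolding I_def m_def by (rule mu.integral_simple_comp[OF f(2)])
  have total: "(\<Sum>y\<in>I i. m i y) = D" for i
    using comp[of "\<lambda>_. 1" i] mD by simp
  define c where "c i = (\<Sum>y\<in>I i. m i y * y) / D" for i
  have finI: "finite (I i)" for i
    using simple_functionD(1)[OF f(2)] by (simp add: I_def)
  let ?law = "\<lambda>i P. prob_space P \<and> sets P = sets borel \<and> (AE x in P. 0 \<le> x) \<and>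
    (\<forall>s\<ge>0. (\<integral>\<^sup>+x. ennreal (exp (- s * x)) \<partial>P) = ennreal (\<Prod>y\<in>I i. (1 + s * y) powr (- m i y))) \<and>
    (\<forall>h. convex_on UNIV h \<longrightarrow> (\<forall>x. 0 \<le> h x) \<longrightarrow>
      (\<integral>\<^sup>+t. ennreal (h (c i * t)) \<partial>gamma_measure D) \<le> (\<integral>\<^sup>+x. ennreal (h x) \<partial>P))"
  have "\<exists>P. ?law i P" for i
    unfolding c_def total[of i, symmetric]
  proof (rule gamma_mixture_law)
    show "I i \<noteq> {}" using total[of i] D by auto
  qed (use finI f(4) in \<open>auto simp: I_def\<close>)
  then have "\<forall>i. \<exists>P. ?law i P" by (rule allI)
  from choice[OF this] obtain P where law: "\<forall>i. ?law i (P i)" ..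
  have P: "prob_space (P i)" "sets (P i) = sets borel" "AE x in P i. 0 \<le> x" for i
    using law by auto
  have PL: "(\<integral>\<^sup>+x. ennreal (exp (- s * x)) \<partial>P i) = ennreal (\<Prod>y\<in>I i. (1 + s * y) powr (- m i y))"
    if "0 \<le> s" for i s
    using law that by simp
  have PC: "(\<integral>\<^sup>+t. ennreal (h (c i * t)) \<partial>gamma_measure D) \<le> (\<integral>\<^sup>+x. ennreal (h x) \<partial>P i)" for i
    using law h by simp
  note P(2) [measurable_cong]
  let ?Q = "distr M borel X"
  have Q: "prob_space ?Q" "sets ?Q = sets borel" "AE x in ?Q. 0 \<le> x"
    using X0 by (auto intro!: M.prob_space_distr simp: AE_distr_iff)
  have transforms: "(\<lambda>i. \<integral>x. exp (- s * x) \<partial>P i) \<longlonglongrightarrow> (\<integral>x. exp (- s * x) \<partial>?Q)" if s: "0 \<le> s" for s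
  proof -
    have ilog: "integrable \<mu> (\<lambda>u. ln (1 + s / u))"
      and "(\<integral>\<omega>. exp (- s * X \<omega>) \<partial>M) = exp (- (\<integral>u. ln (1 + s / u) \<partial>\<mu>))"
      using ggc s by (auto simp: GGC_def)
    then have Qs: "(\<integral>x. exp (- s * x) \<partial>?Q) = exp (- (\<integral>u. ln (1 + s / u) \<partial>\<mu>))"
      by (subst integral_distr) auto
    have Ps: "(\<integral>x. exp (- s * x) \<partial>P i) = exp (- (\<integral>u. ln (1 + s * f i u) \<partial>\<mu>))" for i
    proof -
      have "(\<integral>x. exp (- s * x) \<partial>P i) = (\<Prod>y\<in>I i. (1 + s * y) powr (- m i y))"
        by (subst integral_eq_nn_integral)
           (use PL[OF s, of i] in \<open>auto simp: prod_nonneg\<close>)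
      also have "\<dots> = (\<Prod>y\<in>I i. exp (- (m i y * ln (1 + s * y))))"
      proof (rule prod.cong[OF refl])
        fix y assume "y \<in> I i"
        then have "0 \<le> y" using f(4) by (auto simp: I_def)
        then have "0 < 1 + s * y" using s by (simp add: add_pos_nonneg)
        then show "(1 + s * y) powr (- m i y) = exp (- (m i y * ln (1 + s * y)))"
          by (simp add: powr_def)
      qed
      also have "\<dots> = exp (- (\<integral>u. ln (1 + s * f i u) \<partial>\<mu>))"
        using finI[of i] comp[of "\<lambda>y. ln (1 + s * y)" i] by (simp add: exp_sum[symmetric] sum_negf)
      finally show ?thesis .
    qed
    \<comment> \<open>Since \<open>f i u \<le> 1 / u\<close>, the integrand of the limit is itself a
      majorant.\<close>
    have "(\<lambda>i. \<integral>u. ln (1 + s * f i u) \<partial>\<mu>) \<longlonglongrightarrow> (\<integral>u. ln (1 + s / u) \<partial>\<mu>)"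
    proof (rule integral_dominated_convergence[where w="\<lambda>u. ln (1 + s / u)"])
      show "AE u in \<mu>. (\<lambda>i. ln (1 + s * f i u)) \<longlonglongrightarrow> ln (1 + s / u)"
      proof (rule AE_I2)
        fix u assume u: "u \<in> space \<mu>"
        then have "0 \<le> s / u" using s by (simp add: space)
        then have "1 + s * (1 / u) \<noteq> 0" by simp
        then have "(\<lambda>i. ln (1 + s * f i u)) \<longlonglongrightarrow> ln (1 + s * (1 / u))"
          by (intro tendsto_intros flim u)
        then show "(\<lambda>i. ln (1 + s * f i u)) \<longlonglongrightarrow> ln (1 + s / u)" by simp
      qed
      show "AE u in \<mu>. norm (ln (1 + s * f i u)) \<le> ln (1 + s / u)" for i
      proof (rule AE_I2)
        fix u assume u: "u \<in> space \<mu>"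
        have "0 \<le> s * f i u" using s f(4) by simp
        moreover have "s * f i u \<le> s * (1 / u)" using s fle[OF u] by (intro mult_left_mono)
        ultimately show "norm (ln (1 + s * f i u)) \<le> ln (1 + s / u)" by simp
      qed
    qed (use ilog in auto)
    then show ?thesis unfolding Ps Qs by (intro tendsto_intros)
  qed
  have limP: "(\<lambda>i. \<integral>x. h x \<partial>P i) \<longlonglongrightarrow> (\<integral>x. h x \<partial>?Q)"
    by (rule laplace_continuity[OF P Q transforms cont van])
  have c0: "0 \<le> c i" for i
    unfolding c_def using D f(4) by (intro divide_nonneg_pos sum_nonneg) (auto simp: I_def)
  \<comment> \<open>\<open>c i\<close> is the integral of \<open>f i\<close> divided by
    \<open>D\<close>; its limit is \<open>1 / D\<close> because \<open>1 / u\<close> has integral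
    1.\<close>
  have "(\<lambda>i. \<integral>u. f i u \<partial>\<mu>) \<longlonglongrightarrow> (\<integral>u. 1 / u \<partial>\<mu>)"
    by (rule integral_dominated_convergence[where w="\<lambda>u. 1 / u"])
       (use vmean flim fle f(4) in \<open>auto simp: has_bochner_integral_iff intro!: AE_I2\<close>)
  then have "(\<lambda>i. (\<integral>u. f i u \<partial>\<mu>) / D) \<longlonglongrightarrow> 1 / D"
    using D vmean by (intro tendsto_intros) (auto simp: has_bochner_integral_iff)
  moreover have "(\<integral>u. f i u \<partial>\<mu>) / D = c i" for i
    using comp[of "\<lambda>y. y" i] by (simp add: c_def)
  ultimately have clim: "c \<longlonglongrightarrow> 1 / D" by simp
  have limG: "(\<lambda>i. \<integral>t. h (c i * t) \<partial>gamma_measure D) \<longlonglongrightarrow> (\<integral>t. h (t / D) \<partial>gamma_measure D)"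
  proof (rule integral_dominated_convergence[where w="\<lambda>_. C"])
    show "AE t in gamma_measure D. (\<lambda>i. h (c i * t)) \<longlonglongrightarrow> h (t / D)"
    proof (rule AE_I2)
      fix t
      have "(\<lambda>i. c i * t) \<longlonglongrightarrow> 1 / D * t" by (intro tendsto_intros clim)
      then show "(\<lambda>i. h (c i * t)) \<longlonglongrightarrow> h (t / D)"
        using cont by (auto intro: continuous_on_tendsto_compose)
    qed
    show "AE t in gamma_measure D. norm (h (c i * t)) \<le> C" for i
      using AE_gamma_measure_pos[of D] by eventually_elim (intro C mult_nonneg_nonneg c0 less_imp_le)
  qed auto
  have le: "(\<integral>t. h (c i * t) \<partial>gamma_measure D) \<le> (\<integral>x. h x \<partial>P i)" for i
  proof -
    interpret P: prob_space "P i" by (rule P)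
    have i1: "integrable (gamma_measure D) (\<lambda>t. h (c i * t))"
      using AE_gamma_measure_pos[of D]
      by (intro G.integrable_const_bound[where B=C])
         (auto elim!: eventually_mono simp del: real_norm_def intro!: C mult_nonneg_nonneg c0)
    have i2: "integrable (P i) h"
      using P(3)[of i] C by (intro P.integrable_const_bound[where B=C]) (auto elim!: eventually_mono)
    have "ennreal (\<integral>t. h (c i * t) \<partial>gamma_measure D) \<le> ennreal (\<integral>x. h x \<partial>P i)"
      using PC[of i] i1 i2 h(2) by (simp add: nn_integral_eq_integral)
    then show ?thesis using h(2) by (simp add: ennreal_le_iff integral_nonneg)
  qed
  have "(\<integral>t. h (t / D) \<partial>gamma_measure D) \<le> (\<integral>x. h x \<partial>?Q)"
    by (rule LIMSEQ_le[OF limG limP]) (use le in auto)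
  also have "\<dots> = (\<integral>\<omega>. h (X \<omega>) \<partial>M)" by (rule integral_distr) auto
  finally show ?thesis .
qed

section \<open>Convex order\<close>

lemma gamma_density_size_bias:
  assumes "0 < D"
  shows "gamma_density D D x * x = gamma_density (D + 1) D x"
proof -
  have "Gamma (D + 1) = D * Gamma D"
    using assms by (intro Gamma_plus1) (auto simp: nonpos_Ints_def)
  then show ?thesis
    using assms Gamma_real_pos[of D]
    by (auto simp: gamma_density_def powr_diff powr_add)
qed

text \<open>Size-biasing raises the shape from \<open>D\<close> to \<open>D + 1\<close> with no
  extra factor, because shape and rate agree; the mean is therefore the total mass of a gamma
  density.\<close>

lemma gamma_distributed_mean:
  assumes D: "0 < D" and U: "distributed N lborel U (\<lambda>x. ennreal (gamma_density D D x))"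
  shows "AE \<omega> in N. 0 \<le> U \<omega>" "has_bochner_integral N U 1"
proof -
  have [measurable]: "U \<in> borel_measurable N" using distributed_measurable[OF U] by simp
  have "(\<integral>\<^sup>+\<omega>. indicator {..<0} (U \<omega>) \<partial>N) = (\<integral>\<^sup>+x. ennreal (gamma_density D D x) * indicator {..<0} x \<partial>lborel)"
    using distributed_nn_integral[OF U, of "indicator {..<0}"] by simp
  also have "\<dots> = (\<integral>\<^sup>+x. 0 \<partial>(lborel :: real measure))"
    by (intro nn_integral_cong) (auto simp: gamma_density_def indicator_def)
  finally have "AE \<omega> in N. indicator {..<0} (U \<omega>) = (0 :: ennreal)"
    by (simp add: nn_integral_0_iff_AE)
  then show U0: "AE \<omega> in N. 0 \<le> U \<omega>"
    by eventually_elim (auto simp: indicator_def split: if_splits)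
  have "(\<integral>\<^sup>+\<omega>. ennreal (U \<omega>) \<partial>N) = (\<integral>\<^sup>+x. ennreal (gamma_density D D x) * ennreal x \<partial>lborel)"
    using distributed_nn_integral[OF U, of ennreal] by simp
  also have "\<dots> = (\<integral>\<^sup>+x. ennreal (gamma_density (D + 1) D x) \<partial>lborel)"
    using D by (intro nn_integral_cong)
      (auto simp: ennreal_mult'[symmetric] gamma_density_nonneg gamma_density_size_bias)
  also have "\<dots> = 1" using D by (intro nn_integral_gamma_density) auto
  finally show "has_bochner_integral N U 1"
    using U0 by (intro has_bochner_integral_nn_integral) auto
qed

text \<open>\<open>U\<close> has the law of \<open>t / D\<close> for \<open>t\<close> of shape
  \<open>D\<close> and rate 1, by the substitution \<open>t = D * x\<close>.\<close>

lemma gamma_distributed_integral: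
  fixes h :: "real \<Rightarrow> real"
  assumes D: "0 < D" and U: "distributed N lborel U (\<lambda>x. ennreal (gamma_density D D x))"
    and h [measurable]: "h \<in> borel_measurable borel" and h0: "\<And>x. 0 \<le> h x"
  shows "(\<integral>\<omega>. h (U \<omega>) \<partial>N) = (\<integral>t. h (t / D) \<partial>gamma_measure D)"
proof -
  have [measurable]: "U \<in> borel_measurable N" using distributed_measurable[OF U] by simp
  have "(\<integral>\<^sup>+\<omega>. ennreal (h (U \<omega>)) \<partial>N) = (\<integral>\<^sup>+x. ennreal (gamma_density D D x) * ennreal (h x) \<partial>lborel)"
    using distributed_nn_integral[OF U, of "\<lambda>x. ennreal (h x)"] by simp
  also have "\<dots> = ennreal \<bar>D\<bar> * (\<integral>\<^sup>+x. ennreal (gamma_density D 1 (0 + D * x)) * ennreal (h ((0 + D * x) / D)) \<partial>lborel)"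
    using D gamma_density_scale[OF D D, of 1]
    by (subst nn_integral_cmult[symmetric])
       (auto simp: ennreal_mult'[symmetric] mult.assoc[symmetric] intro!: nn_integral_cong)
  also have "\<dots> = (\<integral>\<^sup>+t. ennreal (gamma_density D 1 t) * ennreal (h (t / D)) \<partial>lborel)"
    using D by (intro nn_integral_real_affine[symmetric]) auto
  also have "\<dots> = (\<integral>\<^sup>+t. ennreal (h (t / D)) \<partial>gamma_measure D)"
    by (simp add: nn_integral_gamma_measure)
  finally show ?thesis
    using h0 by (simp add: integral_eq_nn_integral)
qed

text \<open>Left of \<open>k\<close> the test function is \<open>g\<close>, right of \<open>k\<close> it is the tangent of \<open>g\<close> at \<open>k\<close>;
  the equal means take care of the tangent, and Fatou's lemma lets \<open>k\<close> tend to infinity.\<close>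

lemma convex_nonneg_order:
  fixes X :: "'a \<Rightarrow> real" and U :: "'b \<Rightarrow> real" and g :: "real \<Rightarrow> real"
  assumes M: "prob_space M" and N: "prob_space N"
    and X: "has_bochner_integral M X 1" "AE \<omega> in M. 0 \<le> X \<omega>"
    and U: "has_bochner_integral N U 1" "AE \<omega> in N. 0 \<le> U \<omega>"
    and trunc: "\<And>h k. convex_on UNIV h \<Longrightarrow> (\<And>x. 0 \<le> h x) \<Longrightarrow> (\<And>x. k \<le> x \<Longrightarrow> h x = 0) \<Longrightarrow>
      (\<integral>\<omega>. h (U \<omega>) \<partial>N) \<le> (\<integral>\<omega>. h (X \<omega>) \<partial>M)"
    and g: "convex_on UNIV g" "\<And>x. 0 \<le> g x" "g 0 = 0"
  shows "(\<integral>\<^sup>+\<omega>. ennreal (g (U \<omega>)) \<partial>N) \<le> (\<integral>\<^sup>+\<omega>. ennreal (g (X \<omega>)) \<partial>M)"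
proof -
  interpret M: prob_space M by (rule M)
  interpret N: prob_space N by (rule N)
  have iX: "integrable M X" "(\<integral>\<omega>. X \<omega> \<partial>M) = 1" and iU: "integrable N U" "(\<integral>\<omega>. U \<omega> \<partial>N) = 1"
    using X(1) U(1) by (auto simp: has_bochner_integral_iff)
  have [measurable]: "X \<in> borel_measurable M" and [measurable]: "U \<in> borel_measurable N"
    using iX iU by auto
  have [measurable]: "g \<in> borel_measurable borel" by (rule convex_imp_borel_measurable[OF g(1)])
  have "\<exists>m. \<forall>y. g k + m * (y - k) \<le> g y" for k
    using convex_on_subgradient[OF g(1)] by metis
  then obtain m where m: "\<And>k y. g k + m k * (y - k) \<le> g y" by metis
  define h where "h k x = g (min x k) - (g k + m k * (min x k - k))" for k x
  define t where "t k x = g k + m k * (x - k)" for k x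
  have [measurable]: "h k \<in> borel_measurable borel" "t k \<in> borel_measurable borel" for k
    unfolding h_def t_def by measurable
  have hconv: "convex_on UNIV (h k)" for k
    unfolding h_def by (rule convex_on_truncated[OF g(1) m])
  have h0: "0 \<le> h k x" for k x using m[of k "min x k"] by (simp add: h_def)
  have hvan: "h k x = 0" if "k \<le> x" for k x using that by (simp add: h_def)
  have htg: "h k x + t k x = g x" if "x \<le> k" for k x using that by (simp add: h_def t_def)
  have ht_le: "h k x + t k x \<le> g x" for k x
    using htg[of x k] hvan[of k x] m[of k x] by (cases "x \<le> k") (auto simp: t_def)
  have ht_nonneg: "0 \<le> h k x + t k x" if "0 < k" "0 \<le> x" for k x
  proof (cases "x \<le> k")
    case False
    \<comment> \<open>The tangent at \<open>k\<close>, evaluated at 0, gives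
      \<open>g k - m k * k \<le> g 0 = 0\<close>. Hence the slope is nonnegative and the tangent
      stays nonnegative to the right of \<open>k\<close>.\<close>
    have "0 \<le> m k * k" using m[of k 0] g(2)[of k] g(3) by simp
    then have "0 \<le> m k" using that by (simp add: zero_le_mult_iff)
    then show ?thesis using False g(2)[of k] h0[of k x] by (simp add: t_def)
  qed (use htg g(2) in simp)
  have step: "(\<integral>\<^sup>+\<omega>. ennreal (h k (U \<omega>) + t k (U \<omega>)) \<partial>N) \<le> (\<integral>\<^sup>+\<omega>. ennreal (g (X \<omega>)) \<partial>M)"
    if k: "0 < k" for k
  proof -
    obtain C where C: "\<And>x. 0 \<le> x \<Longrightarrow> norm (h k x) \<le> C"
      using vanishing_bounded[OF convex_on_continuous[OF open_UNIV hconv] hvan] by auto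
    have ihX: "integrable M (\<lambda>\<omega>. h k (X \<omega>))"
      using X(2) C by (intro M.integrable_const_bound[where B=C]) (auto elim!: eventually_mono)
    have ihU: "integrable N (\<lambda>\<omega>. h k (U \<omega>))"
      using U(2) C by (intro N.integrable_const_bound[where B=C]) (auto elim!: eventually_mono)
    have itX: "integrable M (\<lambda>\<omega>. t k (X \<omega>))" and itU: "integrable N (\<lambda>\<omega>. t k (U \<omega>))"
      using iX iU by (auto simp: t_def)
    have EtX: "(\<integral>\<omega>. t k (X \<omega>) \<partial>M) = g k + m k * (1 - k)"
      and EtU: "(\<integral>\<omega>. t k (U \<omega>) \<partial>N) = g k + m k * (1 - k)"
      using iX iU by (simp_all add: t_def M.prob_space N.prob_space)
    have "(\<integral>\<^sup>+\<omega>. ennreal (h k (U \<omega>) + t k (U \<omega>)) \<partial>N) = ennreal (\<integral>\<omega>. h k (U \<omega>) + t k (U \<omega>) \<partial>N)"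
      using ihU itU U(2) ht_nonneg[OF k]
      by (intro nn_integral_eq_integral) (auto elim!: eventually_mono)
    also have "\<dots> \<le> ennreal (\<integral>\<omega>. h k (X \<omega>) + t k (X \<omega>) \<partial>M)"
      using trunc[OF hconv h0 hvan, of k] ihU itU ihX itX EtX EtU by (intro ennreal_leI) simp
    also have "\<dots> = (\<integral>\<^sup>+\<omega>. ennreal (h k (X \<omega>) + t k (X \<omega>)) \<partial>M)"
      using ihX itX X(2) ht_nonneg[OF k]
      by (intro nn_integral_eq_integral[symmetric]) (auto elim!: eventually_mono)
    also have "\<dots> \<le> (\<integral>\<^sup>+\<omega>. ennreal (g (X \<omega>)) \<partial>M)"
      by (intro nn_integral_mono ennreal_leI ht_le)
    finally show ?thesis .
  qed
  \<comment> \<open>Along \<open>k = Suc n\<close>, which keeps \<open>k\<close> positive, the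
    integrand equals \<open>g (U \<omega>)\<close> as soon as \<open>k\<close> exceeds
    \<open>U \<omega>\<close>.\<close>
  have "(\<integral>\<^sup>+\<omega>. ennreal (g (U \<omega>)) \<partial>N)
    = (\<integral>\<^sup>+\<omega>. liminf (\<lambda>n. ennreal (h (real (Suc n)) (U \<omega>) + t (real (Suc n)) (U \<omega>))) \<partial>N)"
  proof (rule nn_integral_cong)
    fix \<omega>
    obtain n0 where n0: "U \<omega> \<le> real n0" using real_arch_simple by blast
    have "\<forall>\<^sub>F n in sequentially. ennreal (h (real (Suc n)) (U \<omega>) + t (real (Suc n)) (U \<omega>)) = ennreal (g (U \<omega>))"
      using eventually_ge_at_top[of n0]
    proof eventually_elim
      case (elim n)
      then have "U \<omega> \<le> real (Suc n)" using n0 by simp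
      then show ?case by (simp only: htg)
    qed
    then show "ennreal (g (U \<omega>)) = liminf (\<lambda>n. ennreal (h (real (Suc n)) (U \<omega>) + t (real (Suc n)) (U \<omega>)))"
      by (intro lim_imp_Liminf[symmetric] tendsto_eventually) auto
  qed
  also have "\<dots> \<le> liminf (\<lambda>n. \<integral>\<^sup>+\<omega>. ennreal (h (real (Suc n)) (U \<omega>) + t (real (Suc n)) (U \<omega>)) \<partial>N)"
    by (rule nn_integral_liminf) measurable
  also have "\<dots> \<le> (\<integral>\<^sup>+\<omega>. ennreal (g (X \<omega>)) \<partial>M)"
    using step by (intro Liminf_le always_eventually allI) auto
  finally show ?thesis .
qed

theorem proposition7:
  fixes M :: "'a measure" and N :: "'b measure"
    and X :: "'a \<Rightarrow> real" and U :: "'b \<Rightarrow> real"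
    and \<mu> :: "real measure" and D :: real
  assumes "prob_space M" and "prob_space N"
    and "GGC M X \<mu>"
    and "thorin_mass \<mu> = ennreal D"
    and "has_bochner_integral M X 1"
    and "distributed N lborel U (\<lambda>x. ennreal (gamma_density D D x))"
  shows "convex_order N U M X"
  unfolding convex_order_def
proof (intro allI impI)
  fix g :: "real \<Rightarrow> real"
  assume g: "convex_on UNIV g"
  interpret M: prob_space M by fact
  interpret N: prob_space N by fact
  have D: "0 < D"
    using assms(3,4) by (auto simp: GGC_def thorin_mass_def not_le[symmetric] ennreal_neg)
  have X0: "AE \<omega> in M. 0 \<le> X \<omega>" using assms(3) by (simp add: GGC_def)
  note U = gamma_distributed_mean[OF D assms(6)]
  have iX: "integrable M X" "(\<integral>\<omega>. X \<omega> \<partial>M) = 1" and iU: "integrable N U" "(\<integral>\<omega>. U \<omega> \<partial>N) = 1"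
    using assms(5) U(2) by (auto simp: has_bochner_integral_iff)
  have [measurable]: "X \<in> borel_measurable M" and [measurable]: "U \<in> borel_measurable N"
    using iX iU by auto
  have [measurable]: "g \<in> borel_measurable borel" by (rule convex_imp_borel_measurable[OF g])
  \<comment> \<open>Subtracting the tangent \<open>l\<close> at 0 leaves a convex nonnegative
    \<open>e\<close> with \<open>e 0 = 0\<close>, while \<open>l\<close> has the same expectation
    \<open>l 1\<close> under both variables.\<close>
  obtain s where s: "\<And>y. g 0 + s * (y - 0) \<le> g y"
    using convex_on_subgradient[OF g] by blast
  define l where "l x = g 0 + s * x" for x
  define e where "e x = g x - l x" for x
  have e0: "0 \<le> e x" for x using s[of x] by (simp add: e_def l_def)
  have econv: "convex_on UNIV e"
  proof (rule convex_onI)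
    fix t x y :: real assume "0 < t" "t < 1"
    then show "e ((1 - t) *\<^sub>R x + t *\<^sub>R y) \<le> (1 - t) * e x + t * e y"
      using convex_onD[OF g, of t x y] by (simp add: e_def l_def algebra_simps)
  qed simp
  have [measurable]: "e \<in> borel_measurable borel" by (rule convex_imp_borel_measurable[OF econv])
  have ilX: "integrable M (\<lambda>\<omega>. l (X \<omega>))" and ilU: "integrable N (\<lambda>\<omega>. l (U \<omega>))"
    using iX iU by (auto simp: l_def)
  have ElX: "(\<integral>\<omega>. l (X \<omega>) \<partial>M) = l 1" and ElU: "(\<integral>\<omega>. l (U \<omega>) \<partial>N) = l 1"
    using iX iU by (simp_all add: l_def M.prob_space N.prob_space)
  have g_split: "g x = e x + l x" for x by (simp add: e_def)
  have main: "(\<integral>\<^sup>+\<omega>. ennreal (e (U \<omega>)) \<partial>N) \<le> (\<integral>\<^sup>+\<omega>. ennreal (e (X \<omega>)) \<partial>M)"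
  proof (rule convex_nonneg_order[OF assms(1,2,5) X0 U(2,1) _ econv e0])
    fix h :: "real \<Rightarrow> real" and k assume h: "convex_on UNIV h" "\<And>x. 0 \<le> h x" "\<And>x. k \<le> x \<Longrightarrow> h x = 0"
    show "(\<integral>\<omega>. h (U \<omega>) \<partial>N) \<le> (\<integral>\<omega>. h (X \<omega>) \<partial>M)"
      using convex_truncated_order[OF assms(1,3-5) h]
        gamma_distributed_integral[OF D assms(6) convex_imp_borel_measurable[OF h(1)] h(2)]
      by simp
  qed (simp add: e_def l_def)
  show "ext_expectation N (\<lambda>\<omega>. g (U \<omega>)) \<le> ext_expectation M (\<lambda>\<omega>. g (X \<omega>))"
  proof (cases "integrable M (\<lambda>\<omega>. g (X \<omega>))")
    case True
    then have ieX: "integrable M (\<lambda>\<omega>. e (X \<omega>))" using ilX by (simp add: e_def)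
    \<comment> \<open>Integrability passes from \<open>e (X \<omega>)\<close> to
      \<open>e (U \<omega>)\<close> through the inequality \<open>main\<close> itself, so that both
      sides become real expectations.\<close>
    have "(\<integral>\<^sup>+\<omega>. ennreal (e (U \<omega>)) \<partial>N) < \<infinity>"
      using main ieX e0 by (auto simp: nn_integral_eq_integral intro: le_less_trans)
    then have ieU: "integrable N (\<lambda>\<omega>. e (U \<omega>))"
      using e0 by (intro integrableI_nonneg) auto
    then have igU: "integrable N (\<lambda>\<omega>. g (U \<omega>))" using ilU by (simp add: g_split)
    have "(\<integral>\<omega>. e (U \<omega>) \<partial>N) \<le> (\<integral>\<omega>. e (X \<omega>) \<partial>M)"
      using main ieX ieU e0 by (simp add: nn_integral_eq_integral ennreal_le_iff integral_nonneg)
    then have "(\<integral>\<omega>. g (U \<omega>) \<partial>N) \<le> (\<integral>\<omega>. g (X \<omega>) \<partial>M)"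
      using ieX ieU ilX ilU ElX ElU by (simp add: g_split)
    then show ?thesis
      using True igU by (simp add: ext_expectation_eq_integral)
  next
    case False
    \<comment> \<open>The negative part is finite because \<open>g\<close> lies above the integrable
      \<open>l\<close>. Failure of integrability then makes the positive part infinite, and the
      right-hand side is \<open>\<infinity>\<close>.\<close>
    have neg: "(\<integral>\<^sup>+\<omega>. ennreal (- g (X \<omega>)) \<partial>M) < \<infinity>"
    proof -
      have "(\<integral>\<^sup>+\<omega>. ennreal (- g (X \<omega>)) \<partial>M) \<le> (\<integral>\<^sup>+\<omega>. ennreal (norm (l (X \<omega>))) \<partial>M)"
      proof (intro nn_integral_mono ennreal_leI)
        show "- g (X \<omega>) \<le> norm (l (X \<omega>))" for \<omega> using e0[of "X \<omega>"] by (simp add: e_def)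
      qed
      also have "\<dots> < \<infinity>" using ilX by (simp add: integrable_iff_bounded)
      finally show ?thesis .
    qed
    then have "(\<integral>\<^sup>+\<omega>. ennreal (g (X \<omega>)) \<partial>M) = \<infinity>"
      using False by (auto simp: real_integrable_def)
    then have "ext_expectation M (\<lambda>\<omega>. g (X \<omega>)) = \<infinity>"
      using neg by (cases "\<integral>\<^sup>+\<omega>. ennreal (- g (X \<omega>)) \<partial>M") (auto simp: ext_expectation_def enn2ereal_ennreal)
    then show ?thesis by simp
  qed
qed

end
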